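(* Let $\mathbb{W}$ be a super-reflexive Banach space, $\mathbb{U}$ a separable Hilbert space, $T>0$, $\alpha>0$, $\beta\ge0$, $0<\nu<1$, and let $\mathrm{A}:D(\mathrm{A})\subseteq\mathbb{W}\to\mathbb{W}$ be a closed, densely defined linear operator which is sectorial of angle $\frac{\nu\pi}{2}$ and such that $(\lambda_0\mathrm{I}-\mathrm{A})^{-1}$ is compact for some $\lambda_0\in\rho(\mathrm{A})$. Let $(\mathscr{G}(t))_{t\ge0}$ be the $(\alpha,\beta,\nu)$-resolvent family generated by $\mathrm{A}$, let $\mathrm{B}:\mathbb{U}\to\mathbb{W}$ be a bounded linear operator, and let $\lambda>0$, $\zeta_1\in\mathbb{W}$. Then for any $\zeta\in\mathbb{W}$ the problem of minimizing $$\mathscr{H}(w,u)=\|w(T)-\zeta_1\|_{\mathbb{W}}^2+\lambda\int_0^T\|u(t)\|_{\mathbb{U}}^2\,\mathrm{d}t$$ over the set $\mathcal{A}_{\mathrm{ad}}$ of all pairs $(w,u)$ with $u\in\mathrm{L}^2([0,T];\mathbb{U})$ and $w\in C([0,T];\mathbb{W})$ given by $$w(t)=\mathscr{G}(t)\zeta+\int_0^t\mathscr{G}(t-s)\mathrm{B}u(s)\,\mathrm{d}s,\quad t\in[0,T],$$ possesses a unique optimal pair $(w^0,u^0)\in\mathcal{A}_{\mathrm{ad}}$.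
   Context: The function $w$ in the definition of $\mathcal{A}_{\mathrm{ad}}$ is the (unique) mild solution, corresponding to the control $u$, of $w'(t)=\mathrm{A}w(t)+\int_0^t\kappa(t-s)\mathrm{A}w(s)\,\mathrm{d}s+\mathrm{B}u(t)$, $t\in(0,T]$, $w(0)=\zeta$, with $\kappa(t)=\alpha e^{-\beta t}\frac{t^{\nu-1}}{\Gamma(\nu)}$. Super-reflexive: every Banach space finitely representable in $\mathbb{W}$ is reflexive (equivalently, $\mathbb{W}$ admits an equivalent uniformly convex norm). Sectorial operator: $\mathrm{A}$ is sectorial of angle $\theta\in(0,\frac{\pi}{2}]$ if $\Sigma_\theta:=\{\lambda\in\mathbb{C}\setminus\{0\}:|\arg(\lambda)|<\theta+\frac{\pi}{2}\}\subset\rho(\mathrm{A})$ and for each $\omega\in(0,\theta)$ there exists $K_\omega\ge1$ such that $\|(\lambda\mathrm{I}-\mathrm{A})^{-1}\|\le K_\omega/|\lambda|$ for all $0\ne\lambda\in\overline{\Sigma}_{\theta-\omega}$. (If the scalar field is real, resolvent set and resolvents are understood in the complexification.) $(\alpha,\beta,\nu)$-resolvent family: the family $(\mathscr{G}(t))_{t\ge0}=(\mathscr{G}_{\alpha,\beta}^{\nu}(t))_{t\ge 0}$ of bounded linear operators on $\mathbb{W}$ such that (a) $\mathscr{G}(\cdot)$ is strongly continuous on $[0,\infty)$ and $\mathscr{G}(0)=\mathrm{I}$; (b) $\mathscr{G}(t)z\in D(\mathrm{A})$ and $\mathscr{G}(t)\mathrm{A}z=\mathrm{A}\mathscr{G}(t)z$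 for all $z\in D(\mathrm{A})$, $t\ge0$; (c) $\mathscr{G}(t)z=z+\int_0^t(1+1*\kappa)(t-s)\mathrm{A}\mathscr{G}(s)z\,\mathrm{d}s$ for all $z\in D(\mathrm{A})$, $t\ge0$, where $(1*\kappa)(t)=\int_0^t\kappa(s)\,\mathrm{d}s$. If $\mathrm{A}$ is sectorial of angle $\frac{\nu\pi}{2}$, such a family exists and is unique. *)

theory Defs
  imports "HOL-Analysis.Analysis"
begin

section \<open>Super-reflexivity\<close>

text \<open>Subspaces of a normed type serve as normed spaces in their own right. Elements of the dual of
  \<open>X\<close> are the bounded linear functionals on \<open>X\<close>, made extensional by the value 0 outside \<open>X\<close>.\<close>

definition dual_space :: "'a::real_normed_vector set \<Rightarrow> ('a \<Rightarrow> real) set" where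
  "dual_space X = {f.
     (\<forall>x\<in>X. \<forall>y\<in>X. f (x + y) = f x + f y) \<and> (\<forall>c. \<forall>x\<in>X. f (c *\<^sub>R x) = c * f x) \<and>
     (\<exists>K. \<forall>x\<in>X. \<bar>f x\<bar> \<le> K * norm x) \<and> (\<forall>x. x \<notin> X \<longrightarrow> f x = 0)}"

definition dual_norm :: "'a::real_normed_vector set \<Rightarrow> ('a \<Rightarrow> real) \<Rightarrow> real" where
  "dual_norm X f = (SUP x\<in>X \<inter> cball 0 1. \<bar>f x\<bar>)"

definition bidual_functional ::
    "'a::real_normed_vector set \<Rightarrow> (('a \<Rightarrow> real) \<Rightarrow> real) \<Rightarrow> bool" where
  "bidual_functional X \<phi> \<longleftrightarrow>
     (\<forall>f\<in>dual_space X. \<forall>g\<in>dual_space X. \<phi> (\<lambda>x. f x + g x) = \<phi> f + \<phi> g) \<and>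
     (\<forall>c. \<forall>f\<in>dual_space X. \<phi> (\<lambda>x. c * f x) = c * \<phi> f) \<and>
     (\<exists>K. \<forall>f\<in>dual_space X. \<bar>\<phi> f\<bar> \<le> K * dual_norm X f)"

definition reflexive_subspace :: "'a::real_normed_vector set \<Rightarrow> bool" where
  "reflexive_subspace X \<longleftrightarrow>
     (\<forall>\<phi>. bidual_functional X \<phi> \<longrightarrow> (\<exists>x\<in>X. \<forall>f\<in>dual_space X. \<phi> f = f x))"

text \<open>The embedding is normalised so that its inverse is a contraction, and it is taken linear on the
  whole type, which is no restriction: linear maps on a subspace extend.\<close>

definition finitely_representable_in ::
    "'a::real_normed_vector set \<Rightarrow> 'w::real_normed_vector itself \<Rightarrow> bool" where
  "finitely_representable_in X W \<longleftrightarrow>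
     (\<forall>\<epsilon>>0. \<forall>E. subspace E \<and> E \<subseteq> X \<and> (\<exists>S. finite S \<and> span S = E) \<longrightarrow>
        (\<exists>f::'a \<Rightarrow> 'w. linear f \<and>
           (\<forall>x\<in>E. norm x \<le> norm (f x) \<and> norm (f x) \<le> (1 + \<epsilon>) * norm x)))"

text \<open>``Every Banach space finitely representable in \<open>W\<close> is reflexive''. Since one cannot quantify over
  types, the Banach spaces range over the closed subspaces of \<open>nat \<Rightarrow>\<^sub>C real\<close>, i.e. of
  the space of all bounded sequences, which contains an isometric copy of every separable Banach
  space. Nothing is lost: finite representability passes to subspaces, and a Banach space is reflexive
  once all its closed separable subspaces are.\<close>

definition super_reflexive :: "'w::banach itself \<Rightarrow> bool" where
  "super_reflexive W \<longleftrightarrow>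
     (\<forall>X :: (nat \<Rightarrow>\<^sub>C real) set.
        subspace X \<and> closed X \<and> finitely_representable_in X W \<longrightarrow> reflexive_subspace X)"

section \<open>Unbounded operators, resolvents, sectoriality\<close>

text \<open>An unbounded operator is given by its domain \<open>D\<close> and a function whose values outside \<open>D\<close> are
  irrelevant.\<close>

definition closed_densely_defined :: "'w::real_normed_vector set \<Rightarrow> ('w \<Rightarrow> 'w) \<Rightarrow> bool" where
  "closed_densely_defined D A \<longleftrightarrow>
     subspace D \<and>
     (\<forall>x\<in>D. \<forall>y\<in>D. A (x + y) = A x + A y) \<and> (\<forall>c. \<forall>x\<in>D. A (c *\<^sub>R x) = c *\<^sub>R A x) \<and>
     closed {(x, A x) |x. x \<in> D} \<and>
     closure D = UNIV"

text \<open>Complex scalars enter through an explicit scalar multiplication \<open>cs\<close>. A complex Banach space is a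
  real one with a scalar multiplication as follows.\<close>

definition complex_normed_scaling :: "(complex \<Rightarrow> 'w \<Rightarrow> 'w::real_normed_vector) \<Rightarrow> bool" where
  "complex_normed_scaling cs \<longleftrightarrow>
     vector_space cs \<and> (\<forall>r x. cs (of_real r) x = r *\<^sub>R x) \<and>
     (\<forall>c x. norm (cs c x) = cmod c * norm x)"

definition complex_linear_operator ::
    "(complex \<Rightarrow> 'w \<Rightarrow> 'w) \<Rightarrow> 'w set \<Rightarrow> ('w \<Rightarrow> 'w) \<Rightarrow> bool" where
  "complex_linear_operator cs D A \<longleftrightarrow> (\<forall>c. \<forall>x\<in>D. cs c x \<in> D \<and> A (cs c x) = cs c (A x))"

text \<open>The complexification of a real space is \<open>'w \<times> 'w\<close>, the pair \<open>(x, y)\<close> standing for \<open>x + iy\<close>. The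
  library's product norm is equivalent to the usual complexification norms, and sectoriality and
  compactness of resolvents do not change under equivalent norms.\<close>

definition complexified_scaling ::
    "complex \<Rightarrow> 'w \<times> 'w \<Rightarrow> 'w::real_normed_vector \<times> 'w" where
  "complexified_scaling c z =
     (Re c *\<^sub>R fst z - Im c *\<^sub>R snd z, Im c *\<^sub>R fst z + Re c *\<^sub>R snd z)"

definition resolvent ::
    "(complex \<Rightarrow> 'w \<Rightarrow> 'w) \<Rightarrow> 'w set \<Rightarrow> ('w \<Rightarrow> 'w) \<Rightarrow> complex \<Rightarrow> 'w \<Rightarrow> 'w::real_normed_vector" where
  "resolvent cs D A l = inv_into D (\<lambda>x. cs l x - A x)"

definition resolvent_set ::
    "(complex \<Rightarrow> 'w \<Rightarrow> 'w) \<Rightarrow> 'w set \<Rightarrow> ('w \<Rightarrow> 'w::real_normed_vector) \<Rightarrow> complex set" where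
  "resolvent_set cs D A =
     {l. bij_betw (\<lambda>x. cs l x - A x) D UNIV \<and> bounded_linear (resolvent cs D A l)}"

definition sector :: "real \<Rightarrow> complex set" where
  "sector \<theta> = {l. l \<noteq> 0 \<and> \<bar>Arg l\<bar> < \<theta> + pi / 2}"

definition sectorial ::
    "(complex \<Rightarrow> 'w \<Rightarrow> 'w) \<Rightarrow> 'w set \<Rightarrow> ('w \<Rightarrow> 'w::real_normed_vector) \<Rightarrow> real \<Rightarrow> bool" where
  "sectorial cs D A \<theta> \<longleftrightarrow>
     0 < \<theta> \<and> \<theta> \<le> pi / 2 \<and> sector \<theta> \<subseteq> resolvent_set cs D A \<and>
     (\<forall>\<omega>\<in>{0<..<\<theta>}. \<exists>K\<ge>1. \<forall>l\<in>closure (sector (\<theta> - \<omega>)) - {0}.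
        onorm (resolvent cs D A l) \<le> K / cmod l)"

definition has_compact_resolvent ::
    "(complex \<Rightarrow> 'w \<Rightarrow> 'w) \<Rightarrow> 'w set \<Rightarrow> ('w \<Rightarrow> 'w::real_normed_vector) \<Rightarrow> bool" where
  "has_compact_resolvent cs D A \<longleftrightarrow>
     (\<exists>l\<in>resolvent_set cs D A. compact (closure (resolvent cs D A l ` cball 0 1)))"

section \<open>Resolvent families\<close>

text \<open>Integrals of functions with values in the possibly non-separable space \<open>'w\<close> are the library's
  gauge integrals, which extend the Bochner integral; the library's Bochner integral requires a
  separable range type. The value of \<open>kernel\<close> at 0 is immaterial.\<close>

definition kernel :: "real \<Rightarrow> real \<Rightarrow> real \<Rightarrow> real \<Rightarrow> real" where
  "kernel \<alpha> \<beta> \<nu> t = \<alpha> * exp (- \<beta> * t) * (t powr (\<nu> - 1) / Gamma \<nu>)"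

definition resolvent_family ::
    "real \<Rightarrow> real \<Rightarrow> real \<Rightarrow> 'w set \<Rightarrow> ('w \<Rightarrow> 'w) \<Rightarrow> (real \<Rightarrow> 'w \<Rightarrow>\<^sub>L 'w::banach) \<Rightarrow> bool" where
  "resolvent_family \<alpha> \<beta> \<nu> D A G \<longleftrightarrow>
     (\<forall>z. continuous_on {0..} (\<lambda>t. G t z)) \<and> G 0 = id_blinfun \<and>
     (\<forall>z\<in>D. \<forall>t\<ge>0. G t z \<in> D \<and> G t (A z) = A (G t z)) \<and>
     (\<forall>z\<in>D. \<forall>t\<ge>0.
        (\<lambda>s. (1 + integral {0..t - s} (kernel \<alpha> \<beta> \<nu>)) *\<^sub>R A (G s z)) integrable_on {0..t} \<and>
        G t z = z + integral {0..t}
          (\<lambda>s. (1 + integral {0..t - s} (kernel \<alpha> \<beta> \<nu>)) *\<^sub>R A (G s z)))"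

section \<open>The control problem\<close>

text \<open>Elements of \<open>L2 T\<close> are functions, not classes; equality of controls is to be read a.e.\<close>

definition L2 :: "real \<Rightarrow> (real \<Rightarrow> 'u::{real_inner,banach,second_countable_topology}) set" where
  "L2 T = {u \<in> borel_measurable (lebesgue_on {0..T}).
     integrable (lebesgue_on {0..T}) (\<lambda>t. (norm (u t))\<^sup>2)}"

definition admissible_pairs ::
    "(real \<Rightarrow> 'w \<Rightarrow>\<^sub>L 'w::banach) \<Rightarrow> ('u::{real_inner,banach,second_countable_topology} \<Rightarrow>\<^sub>L 'w) \<Rightarrow>
      real \<Rightarrow> 'w \<Rightarrow> ((real \<Rightarrow> 'w) \<times> (real \<Rightarrow> 'u)) set" where
  "admissible_pairs G B T \<zeta> = {(w, u). u \<in> L2 T \<and> continuous_on {0..T} w \<and>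
     (\<forall>t\<in>{0..T}. (\<lambda>s. G (t - s) (B (u s))) integrable_on {0..t} \<and>
        w t = G t \<zeta> + integral {0..t} (\<lambda>s. G (t - s) (B (u s))))}"

definition cost ::
    "real \<Rightarrow> 'w \<Rightarrow> real \<Rightarrow> (real \<Rightarrow> 'w::banach) \<times>
      (real \<Rightarrow> 'u::{real_inner,banach,second_countable_topology}) \<Rightarrow> real" where
  "cost T \<zeta>1 \<mu> = (\<lambda>(w, u).
     (norm (w T - \<zeta>1))\<^sup>2 + \<mu> * (\<integral>t. (norm (u t))\<^sup>2 \<partial>lebesgue_on {0..T}))"

definition optimal_pair ::
    "(real \<Rightarrow> 'w \<Rightarrow>\<^sub>L 'w::banach) \<Rightarrow> ('u::{real_inner,banach,second_countable_topology} \<Rightarrow>\<^sub>L 'w) \<Rightarrow>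
      real \<Rightarrow> 'w \<Rightarrow> real \<Rightarrow> 'w \<Rightarrow> (real \<Rightarrow> 'w) \<times> (real \<Rightarrow> 'u) \<Rightarrow> bool" where
  "optimal_pair G B T \<zeta>1 \<mu> \<zeta> = is_arg_min (cost T \<zeta>1 \<mu>) (\<lambda>p. p \<in> admissible_pairs G B T \<zeta>)"

end

theory Submission
  imports Defs
begin

text \<open>The terminal state is an affine, \<open>L\<^sup>1\<close>-continuous function of the control, so the reduced cost is a
  nonnegative convex function of \<open>u\<close> plus \<open>\<mu>\<close> times the squared Hilbert space norm of \<open>u\<close>. By the parallelogram
  law, the squared \<open>L\<^sup>2\<close> distance of two controls is at most \<open>4/\<mu>\<close> times the mean of their excess costs over
  the infimum. Hence minimizing sequences converge in \<open>L\<^sup>2\<close> to the a.e. unique minimizer.\<close>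

text \<open>The main obstacle is integration. The state space may be non-separable and
  \<open>G\<close> is only strongly continuous, so integrability of
  \<open>G (t - s) (B (u s))\<close> in \<open>s\<close> and continuity of its integral in
  \<open>t\<close> are shown for controls of the form indicator times vector and carried to all
  integrable controls by L1 density. The error estimates need one bound on the operator norms over a
  compact time interval, which strong continuity yields through the uniform boundedness principle.
  The same bound makes the terminal state Lipschitz in the L1 norm of the control. Controls are
  functions, so the limit of a minimizing sequence is built pointwise: the sequence is chosen to be
  rapidly Cauchy in L2, hence (finite measure) in L1, and therefore converges almost everywhere. L1
  convergence then passes to the limit in the terminal term, and Fatou's lemma does so in the
  quadratic term.\<close>

section \<open>Uniform boundedness principle\<close>

text \<open>Banach-Steinhaus by Baire category: one of the closed sets \<open>E n\<close> contains a
  ball, and differences of its points bound every \<open>F i\<close> on a ball around 0.\<close>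

lemma uniform_boundedness_blinfun:
  fixes F :: "'i \<Rightarrow> 'a::banach \<Rightarrow>\<^sub>L 'b::real_normed_vector"
  assumes bdd: "\<And>x. \<exists>C. \<forall>i\<in>I. norm (F i x) \<le> C"
  shows "\<exists>M. \<forall>i\<in>I. norm (F i) \<le> M"
proof -
  define E where "E n = {x. \<forall>i\<in>I. norm (F i x) \<le> real n}" for n
  have closed: "closed (E n)" for n
  proof -
    have "E n = (\<Inter>i\<in>I. {x. norm (F i x) \<le> real n})"
      by (auto simp: E_def)
    moreover have "closed {x. norm (F i x) \<le> real n}" for i
      by (intro closed_Collect_le continuous_intros)
    ultimately show ?thesis by auto
  qed
  have "\<Union>(range E) = UNIV"
  proof -
    have "\<exists>n. x \<in> E n" for x
    proof -
      obtain C where "\<forall>i\<in>I. norm (F i x) \<le> C" using bdd by blast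
      moreover obtain n where "C \<le> real n" using real_arch_simple by blast
      ultimately have "x \<in> E n" unfolding E_def by force
      then show ?thesis ..
    qed
    then show ?thesis by blast
  qed
  \<comment> \<open>Baire: closed sets without interior points have a union without interior points,
    whereas this union is the whole space.\<close>
  moreover have "Met_TC.mtopology interior_of \<Union>(range E) = {}" if "\<And>n. interior (E n) = {}"
    by (rule Met_TC.metric_Baire_category_alt)
      (use that closed complete_UNIV in \<open>auto simp: mcomplete_iff_complete\<close>)
  ultimately obtain n where "interior (E n) \<noteq> {}"
    by fastforce
  then obtain x0 r where r: "r > 0" "ball x0 r \<subseteq> E n"
    using mem_interior by blast
  have "norm (F i) \<le> 4 * real n / r" if i: "i \<in> I" for i
  proof (rule norm_blinfun_bound)
    fix y
    show "norm (F i y) \<le> 4 * real n / r * norm y"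
    proof (cases "y = 0")
      case False
      \<comment> \<open>Halving the radius puts \<open>x0 + z\<close> strictly inside the ball.
        Subtracting the value at the center gives \<open>2 * n\<close>, and undoing the scaling
        turns this into \<open>4 * n / r\<close>.\<close>
      define z where "z = (r / (2 * norm y)) *\<^sub>R y"
      have "norm z < r" using False r by (simp add: z_def)
      then have "x0 + z \<in> E n" "x0 \<in> E n" using r by (auto simp: dist_norm)
      then have "norm (F i (x0 + z)) \<le> n" "norm (F i x0) \<le> n"
        using i by (auto simp: E_def)
      moreover have "F i z = F i (x0 + z) - F i x0"
        by (simp add: blinfun.add_right)
      ultimately have "norm (F i z) \<le> 2 * n"
        using norm_triangle_ineq4[of "F i (x0 + z)" "F i x0"] by simp
      moreover have "norm (F i z) = r / (2 * norm y) * norm (F i y)"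
        using r by (simp add: z_def blinfun.scaleR_right)
      ultimately show ?thesis using False r by (simp add: field_simps)
    qed (simp add: blinfun.zero_right)
  qed (use r in simp)
  then show ?thesis by blast
qed

section \<open>Gauge integrability by L1 approximation\<close>

text \<open>Riemann sums of \<open>f - g\<close> are dominated termwise by those of
  \<open>h\<close>, so the Cauchy criterion passes from \<open>g\<close> to \<open>f\<close>.
  Working with sums alone covers values in any Banach space, separable or not.\<close>

lemma integrable_on_L1_approx:
  fixes f :: "'n::euclidean_space \<Rightarrow> 'a::banach"
  assumes approx: "\<And>e. e > 0 \<Longrightarrow> \<exists>g h i. g integrable_on cbox a b \<and> (h has_integral i) (cbox a b) \<and>
    i < e \<and> (\<forall>x\<in>cbox a b. norm (f x - g x) \<le> h x)"
  shows "f integrable_on cbox a b"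
  unfolding integrable_Cauchy
proof (intro allI impI)
  fix e :: real assume "e > 0"
  \<comment> \<open>Riemann sums of \<open>h\<close> will be within \<open>e/6\<close> of
    \<open>i < e/6\<close>, hence below \<open>e/3\<close>. The two passages between
    \<open>f\<close> and \<open>g\<close> and the Cauchy bound for \<open>g\<close> use
    \<open>e/3\<close> each.\<close>
  then obtain g h i where g: "g integrable_on cbox a b" and h: "(h has_integral i) (cbox a b)"
    and i: "i < e/6" and le: "\<And>x. x \<in> cbox a b \<Longrightarrow> norm (f x - g x) \<le> h x"
    using approx[of "e/6"] by fastforce
  obtain \<gamma>1 where \<gamma>1: "gauge \<gamma>1" "\<And>p q. p tagged_division_of (cbox a b) \<Longrightarrow> \<gamma>1 fine p \<Longrightarrow>
      q tagged_division_of (cbox a b) \<Longrightarrow> \<gamma>1 fine q \<Longrightarrow>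
      norm ((\<Sum>(x,K)\<in>p. measure lborel K *\<^sub>R g x) - (\<Sum>(x,K)\<in>q. measure lborel K *\<^sub>R g x)) < e/3"
    using g[unfolded integrable_Cauchy] \<open>e > 0\<close> by (metis divide_pos_pos zero_less_numeral)
  obtain \<gamma>2 where \<gamma>2: "gauge \<gamma>2" "\<And>p. p tagged_division_of (cbox a b) \<Longrightarrow> \<gamma>2 fine p \<Longrightarrow>
      norm ((\<Sum>(x,K)\<in>p. measure lborel K *\<^sub>R h x) - i) < e/6"
    using h \<open>e > 0\<close> unfolding has_integral by (meson divide_pos_pos zero_less_numeral)
  have close: "norm ((\<Sum>(x,K)\<in>p. measure lborel K *\<^sub>R f x) - (\<Sum>(x,K)\<in>p. measure lborel K *\<^sub>R g x)) < e/3"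
    if p: "p tagged_division_of (cbox a b)" "\<gamma>2 fine p" for p
  proof -
    have "(\<Sum>(x,K)\<in>p. measure lborel K *\<^sub>R f x) - (\<Sum>(x,K)\<in>p. measure lborel K *\<^sub>R g x)
        = (\<Sum>(x,K)\<in>p. measure lborel K *\<^sub>R (f x - g x))"
      by (simp add: sum_subtractf[symmetric] case_prod_unfold scaleR_diff_right)
    also have "norm \<dots> \<le> (\<Sum>(x,K)\<in>p. measure lborel K *\<^sub>R h x)"
    proof (rule sum_norm_le)
      fix z assume "z \<in> p"
      then have "fst z \<in> cbox a b"
        using tag_in_interval[OF p(1)] by (metis prod.collapse)
      then show "norm (case z of (x, K) \<Rightarrow> measure lborel K *\<^sub>R (f x - g x)) \<le> (case z of (x, K) \<Rightarrow> measure lborel K *\<^sub>R h x)"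
        using le by (auto simp: case_prod_unfold intro!: mult_left_mono)
    qed
    also have "\<dots> < e/3" using \<gamma>2(2)[OF p] i by (auto simp: abs_real_def split: if_splits)
    finally show ?thesis .
  qed
  note close' = close[THEN norm_minus_commute[THEN ord_eq_less_trans]]
  show "\<exists>\<gamma>. gauge \<gamma> \<and> (\<forall>p q. p tagged_division_of cbox a b \<and> \<gamma> fine p \<and>
      q tagged_division_of cbox a b \<and> \<gamma> fine q \<longrightarrow>
      norm ((\<Sum>(x,K)\<in>p. measure lborel K *\<^sub>R f x) - (\<Sum>(x,K)\<in>q. measure lborel K *\<^sub>R f x)) < e)"
  proof (intro exI[of _ "\<lambda>x. \<gamma>1 x \<inter> \<gamma>2 x"] conjI allI impI)
    show "gauge (\<lambda>x. \<gamma>1 x \<inter> \<gamma>2 x)" using \<gamma>1(1) \<gamma>2(1) by (rule gauge_Int)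
    fix p q
    assume "p tagged_division_of cbox a b \<and> (\<lambda>x. \<gamma>1 x \<inter> \<gamma>2 x) fine p \<and>
      q tagged_division_of cbox a b \<and> (\<lambda>x. \<gamma>1 x \<inter> \<gamma>2 x) fine q"
    then have pq: "p tagged_division_of cbox a b" "q tagged_division_of cbox a b"
      "\<gamma>1 fine p" "\<gamma>2 fine p" "\<gamma>1 fine q" "\<gamma>2 fine q" by (auto simp: fine_Int)
    show "norm ((\<Sum>(x,K)\<in>p. measure lborel K *\<^sub>R f x) - (\<Sum>(x,K)\<in>q. measure lborel K *\<^sub>R f x)) < e"
      using norm_diff_triangle_less[OF norm_diff_triangle_less[OF close[OF pq(1,4)]
          \<gamma>1(2)[OF pq(1,3,2,5)]] close'[OF pq(2,6)]] by simp
  qed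
qed

text \<open>Near a point \<open>x\<close> the function \<open>F\<close> may be replaced by the
  constant \<open>F x\<close>, with an error at most \<open>d\<close> times the modulus of
  \<open>\<phi>\<close>. Interval induction glues these local approximants into a global
  one.\<close>

lemma integrable_on_scaleR_continuous:
  fixes \<phi> :: "real \<Rightarrow> real" and F :: "real \<Rightarrow> 'a::banach"
  assumes \<phi>: "integrable (lebesgue_on {a..b}) \<phi>" and F: "continuous_on {a..b} F"
  shows "(\<lambda>s. \<phi> s *\<^sub>R F s) integrable_on {a..b}"
proof (cases "a \<le> b")
  case True
  have abs_\<phi>: "((\<lambda>s. \<bar>\<phi> s\<bar>) has_integral (\<integral>s. \<bar>\<phi> s\<bar> \<partial>lebesgue_on {a..b})) {a..b}"
    using \<phi> by (intro has_integral_integral_lebesgue_on) auto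
  have step: "\<exists>g. g integrable_on {a..b} \<and> (\<forall>s\<in>{a..b}. norm (\<phi> s *\<^sub>R F s - g s) \<le> d * \<bar>\<phi> s\<bar>)"
    if "d > 0" for d
  proof -
    \<comment> \<open>The intersection with \<open>{a..b}\<close> matters: the local case of the
      induction concerns all short intervals around \<open>x\<close>, including those that stick out
      of \<open>{a..b}\<close>.\<close>
    define P where "P c e \<longleftrightarrow> (\<exists>g. g integrable_on {c..e} \<inter> {a..b} \<and>
      (\<forall>s\<in>{c..e} \<inter> {a..b}. norm (\<phi> s *\<^sub>R F s - g s) \<le> d * \<bar>\<phi> s\<bar>))" for c e
    have "P a b"
    using True proof (induct rule: Bolzano)
      case (trans c e k)
      then obtain g1 g2 where
        g1: "g1 integrable_on {c..e} \<inter> {a..b}" "\<And>s. s\<in>{c..e} \<inter> {a..b} \<Longrightarrow> norm (\<phi> s *\<^sub>R F s - g1 s) \<le> d * \<bar>\<phi> s\<bar>" and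
        g2: "g2 integrable_on {e..k} \<inter> {a..b}" "\<And>s. s\<in>{e..k} \<inter> {a..b} \<Longrightarrow> norm (\<phi> s *\<^sub>R F s - g2 s) \<le> d * \<bar>\<phi> s\<bar>"
        unfolding P_def by blast
      define g where "g s = (if s \<le> e then g1 s else g2 s)" for s
      have "g integrable_on {c..e} \<inter> {a..b}"
        using g1(1) by (rule integrable_eq) (simp add: g_def)
      \<comment> \<open>At the common endpoint \<open>e\<close> the glued function takes the value
        of \<open>g1\<close>; elsewhere on this piece it is \<open>g2\<close>.\<close>
      moreover have "g integrable_on {e..k} \<inter> {a..b}"
        by (rule integrable_spike_finite[OF _ _ g2(1), of "{e}"]) (auto simp: g_def)
      moreover have "negligible (({c..e} \<inter> {a..b}) \<inter> ({e..k} \<inter> {a..b}))"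
        by (rule negligible_subset[of "{e}"]) auto
      moreover have "({c..e} \<inter> {a..b}) \<union> ({e..k} \<inter> {a..b}) = {c..k} \<inter> {a..b}"
        using trans by auto
      ultimately have "g integrable_on {c..k} \<inter> {a..b}"
        by (metis integrable_on_def has_integral_Un)
      moreover have "norm (\<phi> s *\<^sub>R F s - g s) \<le> d * \<bar>\<phi> s\<bar>" if "s\<in>{c..k} \<inter> {a..b}" for s
        using that g1(2)[of s] g2(2)[of s] by (auto simp: g_def)
      ultimately show ?case unfolding P_def by blast
    next
      case (local x)
      obtain r where r: "r > 0" "\<And>s. s \<in> {a..b} \<Longrightarrow> dist s x < r \<Longrightarrow> dist (F s) (F x) < d"
        using F local \<open>d > 0\<close> unfolding continuous_on_iff by fastforce
      have "P c e" if "c \<le> x" "x \<le> e" "e - c < r" for c e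
        unfolding P_def
      proof (intro exI[of _ "\<lambda>s. \<phi> s *\<^sub>R F x"] conjI ballI)
        have "\<phi> integrable_on {a..b}" using \<phi> by (rule integrable_on_lebesgue_on) auto
        then have "\<phi> integrable_on {max a c..min b e}"
          by (rule integrable_on_subinterval) auto
        moreover have "{max a c..min b e} = {c..e} \<inter> {a..b}" by auto
        ultimately show "(\<lambda>s. \<phi> s *\<^sub>R F x) integrable_on {c..e} \<inter> {a..b}"
          by (simp add: integrable_on_scaleR_left)
        fix s assume s: "s \<in> {c..e} \<inter> {a..b}"
        then have "dist (F s) (F x) < d" using that by (intro r) (auto simp: dist_real_def)
        then have "\<bar>\<phi> s\<bar> * norm (F s - F x) \<le> \<bar>\<phi> s\<bar> * d"
          by (intro mult_left_mono) (auto simp: dist_norm)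
        then show "norm (\<phi> s *\<^sub>R F s - \<phi> s *\<^sub>R F x) \<le> d * \<bar>\<phi> s\<bar>"
          by (simp add: scaleR_diff_right[symmetric] mult.commute)
      qed
      then show ?case using \<open>r > 0\<close> by blast
    qed
    then show ?thesis by (simp add: P_def)
  qed
  have "(\<lambda>s. \<phi> s *\<^sub>R F s) integrable_on cbox a b"
  proof (rule integrable_on_L1_approx)
    fix e :: real assume "e > 0"
    define I where "I = (\<integral>s. \<bar>\<phi> s\<bar> \<partial>lebesgue_on {a..b})"
    have "I \<ge> 0" by (simp add: I_def)
    \<comment> \<open>The \<open>+ 1\<close> avoids division by 0 and makes \<open>d * I < e\<close>
      strict.\<close>
    define d where "d = e / (I + 1)"
    have "d > 0" "d * I < e" using \<open>e > 0\<close> \<open>I \<ge> 0\<close> by (auto simp: d_def field_simps)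
    moreover have "((\<lambda>s. d * \<bar>\<phi> s\<bar>) has_integral (d * I)) {a..b}"
      using abs_\<phi> unfolding I_def by (rule has_integral_mult_right)
    ultimately show "\<exists>g h i. g integrable_on cbox a b \<and> (h has_integral i) (cbox a b) \<and>
      i < e \<and> (\<forall>x\<in>cbox a b. norm (\<phi> x *\<^sub>R F x - g x) \<le> h x)"
      using step[of d] unfolding cbox_interval by blast
  qed
  then show ?thesis by simp
qed (simp add: integrable_on_empty)

text \<open>The hypotheses have the shape of the limit case of \<open>integrable_induct\<close>,
  which supplies the domination with \<open>c = 2\<close>.\<close>

lemma L1_tendsto_of_dominated:
  fixes f :: "'a \<Rightarrow> 'b::{banach,second_countable_topology}"
  assumes "integrable M f" "\<And>n. integrable M (S n)"
    and lim: "\<And>x. x \<in> space M \<Longrightarrow> (\<lambda>n. S n x) \<longlonglongrightarrow> f x"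
    and dom: "\<And>n x. x \<in> space M \<Longrightarrow> norm (S n x) \<le> c * norm (f x)"
  shows "(\<lambda>n. \<integral>x. norm (S n x - f x) \<partial>M) \<longlonglongrightarrow> 0"
proof -
  have "(\<lambda>n. \<integral>x. norm (S n x - f x) \<partial>M) \<longlonglongrightarrow> (\<integral>x. 0 \<partial>M)"
  proof (rule integral_dominated_convergence[where w="\<lambda>x. (c + 1) * norm (f x)"])
    show "AE x in M. (\<lambda>n. norm (S n x - f x)) \<longlonglongrightarrow> 0"
      using lim by (auto intro!: AE_I2 simp: tendsto_norm_zero LIM_zero_iff)
    show "AE x in M. norm (norm (S n x - f x)) \<le> (c + 1) * norm (f x)" for n
      using dom by (auto intro!: AE_I2 norm_triangle_le_diff simp: algebra_simps)
  qed (use assms in auto)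
  then show ?thesis by simp
qed

text \<open>Density in \<open>f\<close>: for an indicator times a vector, strong continuity of
  \<open>F\<close> and the scalar-weight lemma suffice, and L1 limits pass through because of the
  norm bound \<open>M\<close>.\<close>

lemma integrable_on_blinfun_apply:
  fixes F :: "real \<Rightarrow> 'u::{banach,second_countable_topology} \<Rightarrow>\<^sub>L 'w::banach"
  assumes f: "integrable (lebesgue_on {a..b}) f"
    and F: "\<And>x. continuous_on {a..b} (\<lambda>s. F s x)" and M: "\<And>s. s \<in> {a..b} \<Longrightarrow> norm (F s) \<le> M"
  shows "(\<lambda>s. F s (f s)) integrable_on {a..b}"
  using f
proof (induct rule: integrable_induct)
  case (base A c)
  then have "(\<lambda>s. indicat_real A s *\<^sub>R F s c) integrable_on {a..b}"
    by (intro integrable_on_scaleR_continuous F) (simp add: less_top)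
  then show ?case by (simp add: blinfun.scaleR_right)
next
  case (add f g)
  then show ?case by (simp add: blinfun.add_right integrable_add)
next
  case (lim f S)
  have to0: "(\<lambda>n. M * (\<integral>x. norm (S n x - f x) \<partial>lebesgue_on {a..b})) \<longlonglongrightarrow> 0"
    using lim by (intro tendsto_mult_right_zero L1_tendsto_of_dominated[where c=2]) auto
  have "(\<lambda>s. F s (f s)) integrable_on cbox a b"
  proof (rule integrable_on_L1_approx)
    fix e :: real assume "e > 0"
    with to0 have "\<forall>\<^sub>F n in sequentially. M * (\<integral>x. norm (S n x - f x) \<partial>lebesgue_on {a..b}) < e"
      by (rule order_tendstoD)
    then obtain n where n: "M * (\<integral>x. norm (S n x - f x) \<partial>lebesgue_on {a..b}) < e"
      by (auto simp: eventually_sequentially)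
    have "((\<lambda>x. M * norm (S n x - f x)) has_integral 
        (M * (\<integral>x. norm (S n x - f x) \<partial>lebesgue_on {a..b}))) (cbox a b)"
      using lim by (auto intro!: has_integral_mult_right has_integral_integral_lebesgue_on)
    moreover have "norm (F s (f s) - F s (S n s)) \<le> M * norm (S n s - f s)" if "s \<in> cbox a b" for s
    proof -
      have "norm (F s (f s) - F s (S n s)) \<le> norm (F s) * norm (f s - S n s)"
        by (simp add: blinfun.diff_right[symmetric] norm_blinfun)
      also have "\<dots> \<le> M * norm (S n s - f s)"
        unfolding norm_minus_commute[of "S n s"] using M that by (intro mult_right_mono) auto
      finally show ?thesis .
    qed
    ultimately show "\<exists>g h i. g integrable_on cbox a b \<and> (h has_integral i) (cbox a b) \<and> i < e \<and>
       (\<forall>x\<in>cbox a b. norm (F x (f x) - g x) \<le> h x)"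
      using lim(2)[of n] n by (intro exI[of _ "\<lambda>s. F s (S n s)"] exI conjI ballI) auto
  qed
  then show ?case by simp
qed

text \<open>Fatou's lemma in terms of Bochner integrals. The bound is asked for eventually because a
  later use controls the distance to \<open>U n\<close> only from index \<open>n\<close> on.\<close>

lemma integral_le_of_AE_tendsto:
  fixes f :: "nat \<Rightarrow> 'a \<Rightarrow> real"
  assumes f: "\<And>n. integrable M (f n)" "\<And>n x. 0 \<le> f n x"
    and lim: "AE x in M. (\<lambda>n. f n x) \<longlonglongrightarrow> g x" and [measurable]: "g \<in> borel_measurable M"
    and le: "\<forall>\<^sub>F n in sequentially. integral\<^sup>L M (f n) \<le> C"
  shows "integrable M g" "integral\<^sup>L M g \<le> C"
proof -
  have "C \<ge> 0"
  proof -
    from le obtain n where "integral\<^sup>L M (f n) \<le> C" by (auto simp: eventually_sequentially)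
    moreover have "integral\<^sup>L M (f n) \<ge> 0" using f by simp
    ultimately show ?thesis by simp
  qed
  have g0: "AE x in M. 0 \<le> g x"
    using lim by eventually_elim (rule LIMSEQ_le_const, auto simp: f)
  have [measurable]: "f n \<in> borel_measurable M" for n using f(1) by auto
  have "(\<integral>\<^sup>+x. ennreal (g x) \<partial>M) = (\<integral>\<^sup>+x. liminf (\<lambda>n. ennreal (f n x)) \<partial>M)"
  proof (rule nn_integral_cong_AE)
    show "AE x in M. ennreal (g x) = liminf (\<lambda>n. ennreal (f n x))"
      using lim by eventually_elim (metis lim_imp_Liminf sequentially_bot tendsto_ennrealI)
  qed
  also have "\<dots> \<le> liminf (\<lambda>n. \<integral>\<^sup>+x. ennreal (f n x) \<partial>M)"
    by (rule nn_integral_liminf) auto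
  also have "\<dots> = liminf (\<lambda>n. ennreal (integral\<^sup>L M (f n)))"
    using f by (simp add: nn_integral_eq_integral)
  also have "\<dots> \<le> ennreal C"
  proof (rule order_trans[OF Liminf_le_Limsup Limsup_bounded])
    show "\<forall>\<^sub>F n in sequentially. ennreal (integral\<^sup>L M (f n)) \<le> ennreal C"
      using le by eventually_elim (rule ennreal_leI)
  qed auto
  finally have *: "(\<integral>\<^sup>+x. ennreal (g x) \<partial>M) \<le> ennreal C" .
  then show "integrable M g"
    by (intro integrableI_nonneg) (auto simp: g0 top_unique intro: le_less_trans)
  show "integral\<^sup>L M g \<le> C" using \<open>C \<ge> 0\<close> * by (rule integral_real_bounded)
qed

section \<open>Square integrable functions\<close>

text \<open>Parallelogram law. The subtracted square is the convexity gain that makes minimizing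
  sequences Cauchy.\<close>

lemma norm_midpoint_sq:
  fixes x y :: "'a::real_inner"
  shows "(norm ((1/2) *\<^sub>R (x + y)))\<^sup>2 = ((norm x)\<^sup>2 + (norm y)\<^sup>2) / 2 - (norm (x - y))\<^sup>2 / 4"
proof -
  have "(norm ((1/2) *\<^sub>R (x + y)))\<^sup>2 = (norm (x + y))\<^sup>2 / 4"
    by (simp add: power_divide)
  then show ?thesis
    unfolding power2_norm_eq_inner by (simp add: inner_diff inner_add inner_commute field_simps)
qed

text \<open>Arithmetic-geometric mean inequality; the free weight \<open>c\<close> is later matched
  to the size of the square.\<close>

lemma two_mult_le_sq: "(a::real) \<le> (c + a\<^sup>2 / c) / 2" if "c > 0"
proof -
  have "0 \<le> (a - c)\<^sup>2" by simp
  then show ?thesis using that by (simp add: field_simps power2_eq_square)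
qed

definition square_integrable ::
    "'a measure \<Rightarrow> ('a \<Rightarrow> 'u::{real_inner,banach,second_countable_topology}) set" where
  "square_integrable M = {u \<in> borel_measurable M. integrable M (\<lambda>x. (norm (u x))\<^sup>2)}"

lemma square_integrable_diff:
  assumes "u \<in> square_integrable M" "v \<in> square_integrable M"
  shows "(\<lambda>x. u x - v x) \<in> square_integrable M"
proof -
  have [measurable]: "u \<in> borel_measurable M" "v \<in> borel_measurable M"
    using assms by (auto simp: square_integrable_def)
  have "integrable M (\<lambda>x. (norm (u x - v x))\<^sup>2)"
  proof (rule Bochner_Integration.integrable_bound)
    show "integrable M (\<lambda>x. 2 * ((norm (u x))\<^sup>2 + (norm (v x))\<^sup>2))"
      using assms by (auto simp: square_integrable_def)
    show "AE x in M. norm ((norm (u x - v x))\<^sup>2) \<le> norm (2 * ((norm (u x))\<^sup>2 + (norm (v x))\<^sup>2))"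
    proof (rule AE_I2)
      fix x
      have "0 \<le> (norm (u x + v x))\<^sup>2" by simp
      then have "(norm (u x - v x))\<^sup>2 \<le> 2 * ((norm (u x))\<^sup>2 + (norm (v x))\<^sup>2)"
        by (simp add: power2_norm_eq_inner algebra_simps inner_commute)
      then show "norm ((norm (u x - v x))\<^sup>2) \<le> norm (2 * ((norm (u x))\<^sup>2 + (norm (v x))\<^sup>2))"
        by simp
    qed
  qed auto
  then show ?thesis by (simp add: square_integrable_def)
qed

lemma square_integrable_midpoint:
  assumes "u \<in> square_integrable M" "v \<in> square_integrable M"
  shows "(\<lambda>x. (1/2) *\<^sub>R (u x + v x)) \<in> square_integrable M"
    and "(\<integral>x. (norm ((1/2) *\<^sub>R (u x + v x)))\<^sup>2 \<partial>M) =
      ((\<integral>x. (norm (u x))\<^sup>2 \<partial>M) + (\<integral>x. (norm (v x))\<^sup>2 \<partial>M)) / 2 - (\<integral>x. (norm (u x - v x))\<^sup>2 \<partial>M) / 4"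
  using assms square_integrable_diff[OF assms] by (auto simp add: square_integrable_def norm_midpoint_sq simp del: norm_scaleR)

text \<open>The weighted inequality, integrated. Minimizing its right side over \<open>c\<close>
  would give exactly Cauchy-Schwarz.\<close>

lemma square_integrable_norm:
  assumes "finite_measure M" "u \<in> square_integrable M"
  shows "integrable M (\<lambda>x. norm (u x))"
    and "c > 0 \<Longrightarrow> (\<integral>x. norm (u x) \<partial>M) \<le> (c * measure M (space M) + (\<integral>x. (norm (u x))\<^sup>2 \<partial>M) / c) / 2"
proof -
  interpret finite_measure M by fact
  have int: "integrable M (\<lambda>x. (c + (norm (u x))\<^sup>2 / c) / 2)" for c :: real
    using assms(2) by (auto simp: square_integrable_def)
  have [measurable]: "u \<in> borel_measurable M" using assms by (auto simp: square_integrable_def)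
  show *: "integrable M (\<lambda>x. norm (u x))"
    using int[of 1] by (rule Bochner_Integration.integrable_bound)
      (use two_mult_le_sq[of 1] in \<open>auto intro!: AE_I2 simp: abs_of_nonneg add_nonneg_nonneg\<close>)
  assume "c > 0"
  have "(\<integral>x. norm (u x) \<partial>M) \<le> (\<integral>x. (c + (norm (u x))\<^sup>2 / c) / 2 \<partial>M)"
    using * int \<open>c > 0\<close> by (intro integral_mono two_mult_le_sq)
  also have "\<dots> = (c * measure M (space M) + (\<integral>x. (norm (u x))\<^sup>2 \<partial>M) / c) / 2"
    using assms(2) by (auto simp: square_integrable_def)
  finally show "(\<integral>x. norm (u x) \<partial>M) \<le> (c * measure M (space M) + (\<integral>x. (norm (u x))\<^sup>2 \<partial>M) / c) / 2" .
qed

text \<open>The series of the norms of the increments has a finite integral, so it converges almost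
  everywhere, and \<open>U n\<close> is a telescoping sum of increments.\<close>

lemma AE_convergent_of_summable_L1:
  fixes U :: "nat \<Rightarrow> 'a \<Rightarrow> 'b::{banach,second_countable_topology}"
  assumes int: "\<And>n. integrable M (\<lambda>x. norm (U (Suc n) x - U n x))"
    and sm: "summable (\<lambda>n. \<integral>x. norm (U (Suc n) x - U n x) \<partial>M)"
  shows "AE x in M. convergent (\<lambda>n. U n x)"
proof -
  have [measurable]: "(\<lambda>x. norm (U (Suc n) x - U n x)) \<in> borel_measurable M" for n
    using int by auto
  have "(\<integral>\<^sup>+x. (\<Sum>n. ennreal (norm (U (Suc n) x - U n x))) \<partial>M)
      = (\<Sum>n. ennreal (\<integral>x. norm (U (Suc n) x - U n x) \<partial>M))"
    by (simp add: nn_integral_suminf nn_integral_eq_integral int)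
  also have "\<dots> \<noteq> \<infinity>"
    using sm by (simp add: ennreal_suminf_neq_top)
  finally have "AE x in M. (\<Sum>n. ennreal (norm (U (Suc n) x - U n x))) \<noteq> \<infinity>"
    by (intro nn_integral_PInf_AE) auto
  then show ?thesis
  proof eventually_elim
    case (elim x)
    then have "summable (\<lambda>n. norm (U (Suc n) x - U n x))"
      by (intro summable_suminf_not_top) auto
    then have "summable (\<lambda>n. U (Suc n) x - U n x)"
      by (rule summable_norm_cancel)
    then have "convergent (\<lambda>n. (\<Sum>i<n. U (Suc i) x - U i x) + U 0 x)"
      by (intro convergent_add convergent_const) (simp only: summable_iff_convergent)
    then show ?case by (simp only: sum_lessThan_telescope[of "\<lambda>n. U n x"] diff_add_cancel)
  qed
qed

section \<open>Minimization with a quadratic penalty\<close>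

text \<open>The penalty makes the cost uniformly convex, so two nearly optimal controls are close in
  L2. Continuity of \<open>\<Phi>\<close> is asked for along L1 convergent sequences because this is
  the convergence that the construction of the minimizer provides.\<close>

lemma tikhonov_minimizer:
  fixes \<Phi> :: "('a \<Rightarrow> 'u::{real_inner,banach,second_countable_topology}) \<Rightarrow> real"
  assumes fin: "finite_measure M" and "\<mu> > 0"
    and nonneg: "\<And>u. u \<in> square_integrable M \<Longrightarrow> 0 \<le> \<Phi> u"
    and midconvex: "\<And>u v. u \<in> square_integrable M \<Longrightarrow> v \<in> square_integrable M \<Longrightarrow>
      \<Phi> (\<lambda>x. (1/2) *\<^sub>R (u x + v x)) \<le> (\<Phi> u + \<Phi> v) / 2"
    and cont: "\<And>U u. (\<And>n. U n \<in> square_integrable M) \<Longrightarrow> u \<in> square_integrable M \<Longrightarrow>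
      (\<lambda>n. \<integral>x. norm (U n x - u x) \<partial>M) \<longlonglongrightarrow> 0 \<Longrightarrow> (\<lambda>n. \<Phi> (U n)) \<longlonglongrightarrow> \<Phi> u"
  defines "J \<equiv> \<lambda>u. \<Phi> u + \<mu> * (\<integral>x. (norm (u x))\<^sup>2 \<partial>M)"
  shows "\<exists>u\<in>square_integrable M. (\<forall>v\<in>square_integrable M. J u \<le> J v) \<and>
    (\<forall>v\<in>square_integrable M. J v \<le> J u \<longrightarrow> (AE x in M. v x = u x))"
proof -
  let ?X = "square_integrable M :: ('a \<Rightarrow> 'u) set"
  define m where "m = Inf (J ` ?X)"
  have ne: "(\<lambda>_. 0) \<in> ?X" by (simp add: square_integrable_def)
  have J0: "J u \<ge> 0" if "u \<in> ?X" for u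
    using nonneg[OF that] \<open>\<mu> > 0\<close> by (simp add: J_def)
  have m_le: "m \<le> J u" if "u \<in> ?X" for u
    unfolding m_def using that J0 by (intro cInf_lower bdd_belowI2[of _ 0]) auto
  \<comment> \<open>The midpoint costs at least \<open>m\<close>, so the parallelogram gain cannot
    exceed the mean excess of \<open>u\<close> and \<open>v\<close>.\<close>
  have dist_le: "\<mu> / 4 * (\<integral>x. (norm (u x - v x))\<^sup>2 \<partial>M) \<le> (J u + J v) / 2 - m"
    if "u \<in> ?X" "v \<in> ?X" for u v
  proof -
    let ?w = "\<lambda>x. (1/2) *\<^sub>R (u x + v x)"
    have "m \<le> J ?w" using square_integrable_midpoint(1)[OF that] by (rule m_le)
    also have "J ?w \<le> (J u + J v) / 2 - \<mu> / 4 * (\<integral>x. (norm (u x - v x))\<^sup>2 \<partial>M)"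
      using midconvex[OF that] unfolding J_def square_integrable_midpoint(2)[OF that]
      by (simp add: algebra_simps add_divide_distrib)
    finally show ?thesis by argo
  qed
  \<comment> \<open>The excess is chosen to cancel the factor \<open>\<mu> / 4\<close> of
    \<open>dist_le\<close>: squared distances become at most \<open>(1/4)^n\<close>, whose square
    roots are summable.\<close>
  have "\<exists>u\<in>?X. J u < m + \<mu> / 4 * (1/4)^n" for n
  proof (rule ccontr)
    assume "\<not> ?thesis"
    then have "m + \<mu> / 4 * (1/4)^n \<le> m"
      using ne unfolding m_def by (intro cInf_greatest) (auto simp: not_less)
    moreover have "\<mu> / 4 * (1/4)^n > 0" using \<open>\<mu> > 0\<close> by simp
    ultimately show False by linarith
  qed
  then obtain U where U: "\<And>n. U n \<in> ?X" "\<And>n. J (U n) < m + \<mu> / 4 * (1/4)^n" by metis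
  define K where "K = (measure M (space M) + 1) / 2"
  have L2: "(\<integral>x. (norm (U k x - U n x))\<^sup>2 \<partial>M) \<le> (1/4)^n" if "n \<le> k" for n k
  proof -
    have "(1/4::real)^k \<le> (1/4)^n" using that by (intro power_decreasing) auto
    then have "\<mu> / 4 * (1/4)^k \<le> \<mu> / 4 * (1/4)^n" using \<open>\<mu> > 0\<close> by simp
    then have "\<mu> / 4 * (\<integral>x. (norm (U k x - U n x))\<^sup>2 \<partial>M) \<le> \<mu> / 4 * (1/4)^n"
      using dist_le[OF U(1)[of k] U(1)[of n]] U(2)[of k] U(2)[of n] by argo
    then show ?thesis using \<open>\<mu> > 0\<close> by simp
  qed
  have intd: "integrable M (\<lambda>x. norm (U k x - U n x))" for n k
    using square_integrable_norm(1)[OF fin square_integrable_diff] U by blast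
  have L1: "(\<integral>x. norm (U k x - U n x) \<partial>M) \<le> K * (1/2)^n" if "n \<le> k" for n k
  proof -
    \<comment> \<open>The weight \<open>(1/2)^n\<close> is the square root of the bound
      \<open>(1/4)^n\<close>. Both summands then have order \<open>(1/2)^n\<close>, which explains
      \<open>K\<close>.\<close>
    have "(\<integral>x. norm (U k x - U n x) \<partial>M) \<le> ((1/2)^n * measure M (space M) +
        (\<integral>x. (norm (U k x - U n x))\<^sup>2 \<partial>M) / (1/2)^n) / 2"
      using square_integrable_norm(2)[OF fin square_integrable_diff[OF U(1) U(1)], of "(1/2)^n"] by simp
    also have "\<dots> \<le> ((1/2)^n * measure M (space M) + (1/4)^n / (1/2)^n) / 2"
      using L2[OF that] by (intro divide_right_mono add_left_mono) auto
    also have "(1/4::real)^n / (1/2)^n = (1/2)^n"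
      by (simp add: power_divide[symmetric])
    finally show ?thesis by (simp add: K_def field_simps)
  qed
  have conv: "AE x in M. convergent (\<lambda>n. U n x)"
  proof (rule AE_convergent_of_summable_L1)
    show "summable (\<lambda>n. \<integral>x. norm (U (Suc n) x - U n x) \<partial>M)"
    proof (rule summable_comparison_test')
      show "summable (\<lambda>n. K * (1/2)^n)" by (intro summable_mult summable_geometric) simp
      show "norm (\<integral>x. norm (U (Suc n) x - U n x) \<partial>M) \<le> K * (1/2)^n" for n
        using L1[of n "Suc n"] by simp
    qed
  qed (rule intd)
  define u where "u x = lim (\<lambda>n. U n x)" for x
  have lim: "AE x in M. (\<lambda>n. U n x) \<longlonglongrightarrow> u x"
    using conv by eventually_elim (simp add: u_def convergent_LIMSEQ_iff)
  have [measurable]: "U n \<in> borel_measurable M" for n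
    using U(1) by (auto simp: square_integrable_def)
  have [measurable]: "u \<in> borel_measurable M" unfolding u_def by measurable
  have intU: "integrable M (\<lambda>x. (norm (U n x))\<^sup>2)" for n
    using U(1) by (auto simp: square_integrable_def)
  \<comment> \<open>A crude uniform bound, just to make the limit square integrable by Fatou; the
    sharp bound follows once \<open>\<Phi> (U n)\<close> is known to converge.\<close>
  have "\<forall>\<^sub>F n in sequentially. (\<integral>x. (norm (U n x))\<^sup>2 \<partial>M) \<le> (m + \<mu>) / \<mu>"
  proof (rule always_eventually, rule allI)
    fix n
    have "\<mu> / 4 * (1/4)^n \<le> \<mu> / 4 * 1"
      using \<open>\<mu> > 0\<close> by (intro mult_left_mono power_le_one) auto
    then have "\<mu> * (\<integral>x. (norm (U n x))\<^sup>2 \<partial>M) \<le> m + \<mu>"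
      using U(2)[of n] nonneg[OF U(1)[of n]] \<open>\<mu> > 0\<close> unfolding J_def by argo
    then show "(\<integral>x. (norm (U n x))\<^sup>2 \<partial>M) \<le> (m + \<mu>) / \<mu>"
      using \<open>\<mu> > 0\<close> by (simp add: field_simps)
  qed
  note fatou = integral_le_of_AE_tendsto[OF intU, where g="\<lambda>x. (norm (u x))\<^sup>2"]
  have lim2: "AE x in M. (\<lambda>n. (norm (U n x))\<^sup>2) \<longlonglongrightarrow> (norm (u x))\<^sup>2"
    using lim by eventually_elim (intro tendsto_intros)
  have uX: "u \<in> ?X"
    using fatou(1)[OF _ lim2 _ \<open>\<forall>\<^sub>F n in sequentially. _ n\<close>] by (simp add: square_integrable_def)
  \<comment> \<open>In the L1 Cauchy estimate \<open>n\<close> is fixed and the other index tends to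
    infinity.\<close>
  have L1lim: "(\<integral>x. norm (U n x - u x) \<partial>M) \<le> K * (1/2)^n" for n
  proof (rule integral_le_of_AE_tendsto(2)[of M "\<lambda>k x. norm (U k x - U n x)"])
    show "AE x in M. (\<lambda>k. norm (U k x - U n x)) \<longlonglongrightarrow> norm (U n x - u x)"
      using lim by eventually_elim (subst norm_minus_commute, intro tendsto_intros)
    show "\<forall>\<^sub>F k in sequentially. (\<integral>x. norm (U k x - U n x) \<partial>M) \<le> K * (1/2)^n"
      using L1 by (auto simp: eventually_sequentially)
  qed (auto intro: intd)
  have "(\<lambda>n. \<integral>x. norm (U n x - u x) \<partial>M) \<longlonglongrightarrow> 0"
  proof (rule tendsto_sandwich[of "\<lambda>_. 0" _ _ "\<lambda>n. K * (1/2)^n"])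
    show "(\<lambda>n. K * (1/2)^n) \<longlonglongrightarrow> 0"
      by (intro tendsto_mult_right_zero LIMSEQ_realpow_zero) auto
  qed (use L1lim in auto)
  then have \<Phi>lim: "(\<lambda>n. \<Phi> (U n)) \<longlonglongrightarrow> \<Phi> u" using U(1) uX by (intro cont)
  \<comment> \<open>The bound on the quadratic term of \<open>U n\<close> varies with
    \<open>n\<close>, through the excess and \<open>\<Phi> (U n)\<close>, while the Fatou lemma
    takes a fixed one; hence the detour through \<open>e\<close>.\<close>
  have "(\<integral>x. (norm (u x))\<^sup>2 \<partial>M) \<le> (m - \<Phi> u) / \<mu>"
  proof (rule field_le_epsilon)
    fix e :: real assume "e > 0"
    have "(\<lambda>n. (m + \<mu> / 4 * (1/4)^n - \<Phi> (U n)) / \<mu>) \<longlonglongrightarrow> (m + \<mu> / 4 * 0 - \<Phi> u) / \<mu>"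
      using \<open>\<mu> > 0\<close> by (intro tendsto_intros \<Phi>lim LIMSEQ_realpow_zero) auto
    then have "\<forall>\<^sub>F n in sequentially. (m + \<mu> / 4 * (1/4)^n - \<Phi> (U n)) / \<mu> < (m - \<Phi> u) / \<mu> + e"
      using \<open>e > 0\<close> by (intro order_tendstoD) auto
    then have "\<forall>\<^sub>F n in sequentially. (\<integral>x. (norm (U n x))\<^sup>2 \<partial>M) \<le> (m - \<Phi> u) / \<mu> + e"
    proof eventually_elim
      case (elim n)
      have "(\<integral>x. (norm (U n x))\<^sup>2 \<partial>M) \<le> (m + \<mu> / 4 * (1/4)^n - \<Phi> (U n)) / \<mu>"
        using U(2)[of n] \<open>\<mu> > 0\<close> by (simp add: J_def field_simps)
      then show ?case using elim by simp
    qed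
    then show "(\<integral>x. (norm (u x))\<^sup>2 \<partial>M) \<le> (m - \<Phi> u) / \<mu> + e"
      by (intro fatou(2)[OF _ lim2]) auto
  qed
  then have Ju: "J u \<le> m" using \<open>\<mu> > 0\<close> by (simp add: J_def field_simps)
  \<comment> \<open>Such a \<open>v\<close> has zero excess as well, so its squared distance to
    \<open>u\<close> integrates to 0.\<close>
  have "AE x in M. v x = u x" if v: "v \<in> ?X" "J v \<le> J u" for v
  proof -
    have "\<mu> / 4 * (\<integral>x. (norm (v x - u x))\<^sup>2 \<partial>M) \<le> 0"
      using dist_le[OF v(1) uX] v(2) Ju by argo
    then have "(\<integral>x. (norm (v x - u x))\<^sup>2 \<partial>M) = 0"
      using \<open>\<mu> > 0\<close> by (simp add: mult_le_0_iff antisym)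
    moreover have "integrable M (\<lambda>x. (norm (v x - u x))\<^sup>2)"
      using square_integrable_diff[OF v(1) uX] by (simp add: square_integrable_def)
    ultimately have "AE x in M. (norm (v x - u x))\<^sup>2 = 0"
      by (subst (asm) integral_nonneg_eq_0_iff_AE) auto
    then show ?thesis by simp
  qed
  moreover have "J u \<le> J v" if "v \<in> ?X" for v using Ju m_le[OF that] by simp
  ultimately show ?thesis using uX by blast
qed

section \<open>Convolution with a strongly continuous operator family\<close>

lemma integral_norm_diff_bound:
  fixes f g :: "'n::euclidean_space \<Rightarrow> 'a::banach"
  assumes "f integrable_on S" "g integrable_on S" "(h has_integral i) S"
    and "\<And>x. x \<in> S \<Longrightarrow> norm (f x - g x) \<le> h x"
  shows "norm (integral S f - integral S g) \<le> i"
proof -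
  have "norm (integral S (\<lambda>x. f x - g x)) \<le> integral S h"
    using assms by (intro integral_norm_bound_integral integrable_diff) auto
  then show ?thesis using assms by (simp add: integral_diff integral_unique)
qed

lemma norm_blinfun_diff_bound:
  assumes "norm F \<le> M"
  shows "norm (blinfun_apply F x - blinfun_apply F y) \<le> M * norm (x - y)"
proof -
  have "norm (F x - F y) \<le> norm F * norm (x - y)"
    by (simp add: blinfun.diff_right[symmetric] norm_blinfun)
  also have "\<dots> \<le> M * norm (x - y)" using assms by (rule mult_right_mono) simp
  finally show ?thesis .
qed

text \<open>With a fixed interval of integration, \<open>t\<close> enters only through the operator.
  For an indicator times a vector, uniform continuity of one orbit is enough; general
  \<open>f\<close> follows as a uniform limit.\<close>

lemma continuous_on_integral_blinfun_shift:
  fixes F :: "real \<Rightarrow> 'u::{banach,second_countable_topology} \<Rightarrow>\<^sub>L 'w::banach"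
  assumes f: "integrable (lebesgue_on {a..b}) f"
    and F: "\<And>x. continuous_on UNIV (\<lambda>r. F r x)"
    and M: "\<And>t s. t \<in> {c..d} \<Longrightarrow> s \<in> {a..b} \<Longrightarrow> norm (F (t - s)) \<le> M"
  shows "continuous_on {c..d} (\<lambda>t. integral {a..b} (\<lambda>s. F (t - s) (f s)))"
proof -
  have F': "continuous_on X (\<lambda>s. F (t - s) x)" for X t x
    by (rule continuous_on_compose2[OF F]) (auto intro!: continuous_intros)
  have int: "(\<lambda>s. F (t - s) (g s)) integrable_on {a..b}"
    if "t \<in> {c..d}" "integrable (lebesgue_on {a..b}) g" for t g
    using that by (intro integrable_on_blinfun_apply[where M=M] F' M) auto
  show ?thesis
  using f
  proof (induct rule: integrable_induct)
    case (base A x)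
    define y where "y = (\<lambda>s. indicat_real A s *\<^sub>R x)"
    have y: "integrable (lebesgue_on {a..b}) y" using base by (simp add: y_def less_top)
    have I: "((\<lambda>_. e) has_integral e * measure lborel {a..b}) {a..b}" for e :: real
      using has_integral_const_real[of e a b] by (simp add: mult.commute)
    \<comment> \<open>All differences \<open>t - s\<close> lie in this compact interval, so one
      \<open>r\<close> serves every \<open>s\<close>.\<close>
    have uc: "uniformly_continuous_on {c-b..d-a} (\<lambda>r. F r x)"
      by (intro compact_uniformly_continuous continuous_on_subset[OF F]) auto
    have "continuous_on {c..d} (\<lambda>t. integral {a..b} (\<lambda>s. F (t - s) (y s)))"
      unfolding continuous_on_iff
    proof (intro ballI allI impI)
      fix t and e :: real assume t: "t \<in> {c..d}" "e > 0"
      define e' where "e' = e / (measure lborel {a..b} + 1)"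
      have e': "e' > 0" "e' * measure lborel {a..b} < e"
        using \<open>e > 0\<close> by (auto simp: e'_def field_simps add_nonneg_pos)
      then obtain r where r: "r > 0" "\<And>p q. p \<in> {c-b..d-a} \<Longrightarrow> q \<in> {c-b..d-a} \<Longrightarrow>
          dist q p < r \<Longrightarrow> dist (F q x) (F p x) < e'"
        using uc unfolding uniformly_continuous_on_def by metis
      have "dist (integral {a..b} (\<lambda>s. F (t' - s) (y s))) (integral {a..b} (\<lambda>s. F (t - s) (y s))) < e"
        if t': "t' \<in> {c..d}" "dist t' t < r" for t'
      proof -
        have "norm (integral {a..b} (\<lambda>s. F (t' - s) (y s)) - integral {a..b} (\<lambda>s. F (t - s) (y s)))
          \<le> e' * measure lborel {a..b}"
        proof (rule integral_norm_diff_bound[OF int[OF t'(1) y] int[OF t(1) y] I])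
          fix s assume "s \<in> {a..b}"
          then have "dist (F (t' - s) x) (F (t - s) x) < e'"
            using t t' by (intro r) (auto simp: dist_real_def)
          then show "norm (F (t' - s) (y s) - F (t - s) (y s)) \<le> e'"
            using e'(1) by (auto simp: y_def indicator_def dist_norm)
        qed
        then show ?thesis using e'(2) by (simp add: dist_norm)
      qed
      then show "\<exists>r>0. \<forall>t'\<in>{c..d}. dist t' t < r \<longrightarrow>
        dist (integral {a..b} (\<lambda>s. F (t' - s) (y s))) (integral {a..b} (\<lambda>s. F (t - s) (y s))) < e"
        using r(1) by blast
    qed
    then show ?case by (simp add: y_def)
  next
    case (add f g)
    then have "continuous_on {c..d} (\<lambda>t. integral {a..b} (\<lambda>s. F (t - s) (f s)) + integral {a..b} (\<lambda>s. F (t - s) (g s)))"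
      by (intro continuous_intros)
    moreover have "integral {a..b} (\<lambda>s. F (t - s) (f s)) + integral {a..b} (\<lambda>s. F (t - s) (g s)) =
        integral {a..b} (\<lambda>s. F (t - s) (f s + g s))" if "t \<in> {c..d}" for t
      using int[OF that add(1)] int[OF that add(3)] by (simp add: blinfun.add_right integral_add)
    ultimately show ?case by (rule continuous_on_eq)
  next
    case (lim f S)
    show ?case
    proof (rule uniform_limit_theorem)
      \<comment> \<open>The right side is free of \<open>t\<close>, so L1 convergence of the
        integrands gives uniform convergence of the integrals.\<close>
      have bound: "dist (integral {a..b} (\<lambda>s. F (t - s) (S n s))) (integral {a..b} (\<lambda>s. F (t - s) (f s)))
          \<le> M * (\<integral>x. norm (S n x - f x) \<partial>lebesgue_on {a..b})" if t: "t \<in> {c..d}" for n t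
      proof -
        have "((\<lambda>s. M * norm (S n s - f s)) has_integral M * (\<integral>x. norm (S n x - f x) \<partial>lebesgue_on {a..b})) {a..b}"
          using lim by (intro has_integral_mult_right has_integral_integral_lebesgue_on) auto
        then show ?thesis unfolding dist_norm
          by (rule integral_norm_diff_bound[OF int[OF t lim(1)] int[OF t lim(5)]])
            (use t M in \<open>blast intro: norm_blinfun_diff_bound\<close>)
      qed
      have to0: "(\<lambda>n. M * (\<integral>x. norm (S n x - f x) \<partial>lebesgue_on {a..b})) \<longlonglongrightarrow> 0"
        using lim by (intro tendsto_mult_right_zero L1_tendsto_of_dominated[where c=2]) auto
      show "uniform_limit {c..d} (\<lambda>n t. integral {a..b} (\<lambda>s. F (t - s) (S n s)))
          (\<lambda>t. integral {a..b} (\<lambda>s. F (t - s) (f s))) sequentially"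
      proof (rule uniform_limitI)
        fix e :: real assume "e > 0"
        with to0 have "\<forall>\<^sub>F n in sequentially. M * (\<integral>x. norm (S n x - f x) \<partial>lebesgue_on {a..b}) < e"
          by (rule order_tendstoD)
        then show "\<forall>\<^sub>F n in sequentially. \<forall>t\<in>{c..d}. dist (integral {a..b} (\<lambda>s. F (t - s) (S n s)))
            (integral {a..b} (\<lambda>s. F (t - s) (f s))) < e"
          by eventually_elim (use bound le_less_trans in blast)
      qed
    qed (use lim in \<open>auto intro!: always_eventually\<close>)
  qed
qed

text \<open>Strong continuity does not make \<open>norm (K t)\<close> continuous in
  \<open>t\<close>. Each orbit is bounded on the compact interval, and the uniform boundedness
  principle does the rest.\<close>

lemma strongly_continuous_norm_bounded:
  fixes K :: "real \<Rightarrow> 'u::banach \<Rightarrow>\<^sub>L 'w::real_normed_vector"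
  assumes "\<And>x. continuous_on {a..b} (\<lambda>t. K t x)"
  shows "\<exists>M. \<forall>t\<in>{a..b}. norm (K t) \<le> M"
proof (rule uniform_boundedness_blinfun)
  fix x
  have "bounded ((\<lambda>t. K t x) ` {a..b})"
    using assms by (intro compact_imp_bounded compact_continuous_image) auto
  then show "\<exists>C. \<forall>t\<in>{a..b}. norm (K t x) \<le> C" by (auto simp: bounded_iff)
qed

text \<open>With \<open>K\<close> extended to the whole line by its boundary values, the
  integral over \<open>{0..t}\<close> is the one over \<open>{0..T}\<close> minus the contribution \<open>K 0 (f s)\<close> of \<open>{t..T}\<close>.\<close>

lemma convolution_blinfun:
  fixes K :: "real \<Rightarrow> 'u::{banach,second_countable_topology} \<Rightarrow>\<^sub>L 'w::banach"
  assumes K: "\<And>x. continuous_on {0..T} (\<lambda>t. K t x)" and f: "integrable (lebesgue_on {0..T}) f"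
  shows convolution_integrable: "t \<in> {0..T} \<Longrightarrow> (\<lambda>s. K (t - s) (f s)) integrable_on {0..t}"
    and convolution_continuous: "continuous_on {0..T} (\<lambda>t. integral {0..t} (\<lambda>s. K (t - s) (f s)))"
proof -
  have "(\<forall>t\<in>{0..T}. (\<lambda>s. K (t - s) (f s)) integrable_on {0..t}) \<and>
    continuous_on {0..T} (\<lambda>t. integral {0..t} (\<lambda>s. K (t - s) (f s)))"
  proof (cases "0 \<le> T")
    case True
    define F where "F r = K (max 0 (min T r))" for r
    obtain M where M: "\<And>t. t \<in> {0..T} \<Longrightarrow> norm (K t) \<le> M"
      using strongly_continuous_norm_bounded[OF K] by blast
    have F: "continuous_on UNIV (\<lambda>r. F r x)" for x
      unfolding F_def using True by (intro continuous_on_compose2[OF K]) (auto intro!: continuous_intros)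
    have FM: "norm (F r) \<le> M" for r unfolding F_def using True by (intro M) auto
    have intF: "(\<lambda>s. F (t - s) (f s)) integrable_on {0..T}" for t
      using f by (rule integrable_on_blinfun_apply)
        (auto intro!: continuous_intros continuous_on_compose2[OF F] FM)
    have int0: "(\<lambda>s. K 0 (f s)) integrable_on {0..T}"
      using f by (rule integrable_on_blinfun_apply[where M="norm (K 0)"]) auto
    have int: "(\<lambda>s. K (t - s) (f s)) integrable_on {0..t}"
      and eq: "integral {0..T} (\<lambda>s. F (t - s) (f s)) - integral {t..T} (\<lambda>s. K 0 (f s)) =
        integral {0..t} (\<lambda>s. K (t - s) (f s))" if t: "t \<in> {0..T}" for t
    proof -
      have F_eq: "F (t - s) = K (t - s)" if "s \<in> {0..t}" for s
      proof -
        have "max 0 (min T (t - s)) = t - s" using t that by auto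
        then show ?thesis by (simp add: F_def)
      qed
      have F_eq0: "F (t - s) = K 0" if "s \<in> {t..T}" for s
      proof -
        have "max 0 (min T (t - s)) = 0" using t that by auto
        then show ?thesis by (simp add: F_def)
      qed
      have "(\<lambda>s. F (t - s) (f s)) integrable_on {0..t}"
        using intF by (rule integrable_on_subinterval) (use t in auto)
      then show "(\<lambda>s. K (t - s) (f s)) integrable_on {0..t}"
        by (rule integrable_eq) (simp add: F_eq)
      have "integral {0..T} (\<lambda>s. F (t - s) (f s)) =
          integral {0..t} (\<lambda>s. F (t - s) (f s)) + integral {t..T} (\<lambda>s. F (t - s) (f s))"
        using t by (intro Henstock_Kurzweil_Integration.integral_combine[OF _ _ intF, symmetric]) auto
      also have "integral {0..t} (\<lambda>s. F (t - s) (f s)) = integral {0..t} (\<lambda>s. K (t - s) (f s))"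
        by (rule integral_cong) (simp add: F_eq)
      also have "integral {t..T} (\<lambda>s. F (t - s) (f s)) = integral {t..T} (\<lambda>s. K 0 (f s))"
        by (rule integral_cong) (simp add: F_eq0)
      finally show "integral {0..T} (\<lambda>s. F (t - s) (f s)) - integral {t..T} (\<lambda>s. K 0 (f s)) =
        integral {0..t} (\<lambda>s. K (t - s) (f s))" by simp
    qed
    \<comment> \<open>The first integral has fixed endpoints; in the second the integrand no longer
      depends on \<open>t\<close>, so it is an indefinite integral.\<close>
    have "continuous_on {0..T} (\<lambda>t. integral {0..T} (\<lambda>s. F (t - s) (f s)) - integral {t..T} (\<lambda>s. K 0 (f s)))"
      by (intro continuous_on_diff continuous_on_integral_blinfun_shift[OF f F FM]
          indefinite_integral_continuous_1'[OF int0])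
    then have "continuous_on {0..T} (\<lambda>t. integral {0..t} (\<lambda>s. K (t - s) (f s)))"
      using eq by (rule continuous_on_eq)
    with int show ?thesis by blast
  qed auto
  then show "t \<in> {0..T} \<Longrightarrow> (\<lambda>s. K (t - s) (f s)) integrable_on {0..t}"
    and "continuous_on {0..T} (\<lambda>t. integral {0..t} (\<lambda>s. K (t - s) (f s)))" by blast+
qed

section \<open>The control problem\<close>

text \<open>In a mere normed space the triangle inequality still makes the squared norm convex, but
  without a gain term. The gain comes from the penalty on the control alone.\<close>

lemma norm_midpoint_sq_le:
  fixes x y :: "'a::real_normed_vector"
  shows "(norm ((1/2) *\<^sub>R (x + y)))\<^sup>2 \<le> ((norm x)\<^sup>2 + (norm y)\<^sup>2) / 2"
proof -
  have "(norm ((1/2) *\<^sub>R (x + y)))\<^sup>2 \<le> ((norm x + norm y) / 2)\<^sup>2"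
    using norm_triangle_ineq[of x y] by (intro power_mono) auto
  also have "\<dots> \<le> ((norm x)\<^sup>2 + (norm y)\<^sup>2) / 2"
    using sum_squares_bound[of "norm x" "norm y"] by (simp add: field_simps power2_eq_square)
  finally show ?thesis .
qed

lemma L2_eq_square_integrable: "L2 T = square_integrable (lebesgue_on {0..T})"
  by (simp add: L2_def square_integrable_def)

theorem theorem3p4:
  fixes T \<alpha> \<beta> \<nu> \<mu> :: real
    and D :: "'w::banach set" and A :: "'w \<Rightarrow> 'w"
    and G :: "real \<Rightarrow> 'w \<Rightarrow>\<^sub>L 'w"
    and B :: "'u::{real_inner,banach,second_countable_topology} \<Rightarrow>\<^sub>L 'w"
    and \<zeta> \<zeta>1 :: 'w
  assumes "super_reflexive TYPE('w)"
    and "T > 0" and "\<alpha> > 0" and "\<beta> \<ge> 0" and "0 < \<nu>" and "\<nu> < 1"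
    and "closed_densely_defined D A"
    and \<comment> \<open>real scalars (via complexification), or complex scalars\<close>
      "(sectorial complexified_scaling (D \<times> D) (map_prod A A) (\<nu> * pi / 2) \<and>
        has_compact_resolvent complexified_scaling (D \<times> D) (map_prod A A)) \<or>
       (\<exists>cs. complex_normed_scaling cs \<and> complex_linear_operator cs D A \<and>
        sectorial cs D A (\<nu> * pi / 2) \<and> has_compact_resolvent cs D A)"
    and "resolvent_family \<alpha> \<beta> \<nu> D A G"
    and "\<mu> > 0"
  shows "\<exists>w0 u0. optimal_pair G B T \<zeta>1 \<mu> \<zeta> (w0, u0) \<and>
    (\<forall>w u. optimal_pair G B T \<zeta>1 \<mu> \<zeta> (w, u) \<longrightarrow>
      (\<forall>t\<in>{0..T}. w t = w0 t) \<and> (AE t in lebesgue_on {0..T}. u t = u0 t))"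
proof -
  let ?M = "lebesgue_on {0..T}"
  have fin: "finite_measure ?M"
    by (simp add: finite_measure_lebesgue_on)
  have G: "continuous_on {0..T} (\<lambda>t. G t z)" for z
    using assms(9) unfolding resolvent_family_def by (auto intro: continuous_on_subset)
  \<comment> \<open>Absorbing \<open>B\<close> into the family makes the integrand an operator
    applied to \<open>u s\<close>, a function with values in the separable control space.\<close>
  define K where "K t = G t o\<^sub>L B" for t
  have K_apply: "K t x = G t (B x)" for t x by (simp add: K_def)
  have K: "continuous_on {0..T} (\<lambda>t. K t x)" for x
    unfolding K_apply by (rule G)
  obtain C where C: "\<And>t. t \<in> {0..T} \<Longrightarrow> norm (K t) \<le> C"
    using strongly_continuous_norm_bounded[OF K] by blast
  define S where "S u t = integral {0..t} (\<lambda>s. K (t - s) (u s))" for u t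
  have L1: "integrable ?M u" if "u \<in> L2 T" for u :: "real \<Rightarrow> 'u"
  proof (rule integrable_norm_iff[THEN iffD1])
    show "integrable ?M (\<lambda>t. norm (u t))"
      using that unfolding L2_eq_square_integrable by (rule square_integrable_norm(1)[OF fin])
  qed (use that in \<open>simp add: L2_def\<close>)
  have int: "(\<lambda>s. K (t - s) (u s)) integrable_on {0..t}" if "u \<in> L2 T" "t \<in> {0..T}" for u t
    using K L1[OF that(1)] that(2) by (rule convolution_integrable)
  \<comment> \<open>Continuity of the state is automatic, so on \<open>{0..T}\<close> the control
    determines the state and the problem becomes one in \<open>u\<close> alone.\<close>
  have admissible: "(w, u) \<in> admissible_pairs G B T \<zeta> \<longleftrightarrow> u \<in> L2 T \<and> (\<forall>t\<in>{0..T}. w t = G t \<zeta> + S u t)" for w u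
  proof -
    have "continuous_on {0..T} w" if "u \<in> L2 T" "\<forall>t\<in>{0..T}. w t = G t \<zeta> + S u t"
    proof -
      have "continuous_on {0..T} (\<lambda>t. G t \<zeta> + S u t)"
        unfolding S_def using K L1[OF that(1)]
        by (intro continuous_on_add G convolution_continuous)
      then show ?thesis using that(2) by (subst continuous_on_cong[OF refl]) auto
    qed
    then show ?thesis
      using int by (auto simp: admissible_pairs_def S_def K_apply)
  qed
  define \<Phi> where "\<Phi> u = (norm (G T \<zeta> + S u T - \<zeta>1))\<^sup>2" for u
  define J where "J u = \<Phi> u + \<mu> * (\<integral>t. (norm (u t))\<^sup>2 \<partial>?M)" for u
  have T: "T \<in> {0..T}" using \<open>T > 0\<close> by simp
  have cost: "cost T \<zeta>1 \<mu> (w, u) = J u" if "(w, u) \<in> admissible_pairs G B T \<zeta>" for w u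
    using that T by (simp add: cost_def J_def \<Phi>_def admissible)
  have "\<exists>u\<in>L2 T. (\<forall>v\<in>L2 T. J u \<le> J v) \<and> (\<forall>v\<in>L2 T. J v \<le> J u \<longrightarrow> (AE t in ?M. v t = u t))"
    unfolding J_def L2_eq_square_integrable
  proof (rule tikhonov_minimizer[OF fin \<open>\<mu> > 0\<close>]; (fold L2_eq_square_integrable)?)
    show "0 \<le> \<Phi> u" for u by (simp add: \<Phi>_def)
  next
    fix u v :: "real \<Rightarrow> 'u" assume u: "u \<in> L2 T" and v: "v \<in> L2 T"
    have "((\<lambda>s. K (T - s) (u s)) has_integral S u T) {0..T}" "((\<lambda>s. K (T - s) (v s)) has_integral S v T) {0..T}"
      unfolding S_def using int[OF u T] int[OF v T] by (simp_all add: integrable_integral)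
    from has_integral_cmul[OF has_integral_add[OF this], of "1/2"]
    have "S (\<lambda>t. (1/2) *\<^sub>R (u t + v t)) T = (1/2) *\<^sub>R (S u T + S v T)"
      unfolding S_def[of "\<lambda>t. (1/2) *\<^sub>R (u t + v t)"]
      by (intro integral_unique) (simp add: blinfun.add_right blinfun.scaleR_right)
    then have "G T \<zeta> + S (\<lambda>t. (1/2) *\<^sub>R (u t + v t)) T - \<zeta>1 =
        (1/2) *\<^sub>R ((G T \<zeta> + S u T - \<zeta>1) + (G T \<zeta> + S v T - \<zeta>1))"
      by (simp add: algebra_simps flip: scaleR_2)
    then show "\<Phi> (\<lambda>t. (1/2) *\<^sub>R (u t + v t)) \<le> (\<Phi> u + \<Phi> v) / 2"
      unfolding \<Phi>_def by (simp only: norm_midpoint_sq_le)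
  next
    fix U and u :: "real \<Rightarrow> 'u"
    assume U: "\<And>n. U n \<in> L2 T" and u: "u \<in> L2 T"
      and lim: "(\<lambda>n. \<integral>t. norm (U n t - u t) \<partial>?M) \<longlonglongrightarrow> 0"
    have "norm (S (U n) T - S u T) \<le> C * (\<integral>t. norm (U n t - u t) \<partial>?M)" for n
      unfolding S_def
    proof (rule integral_norm_diff_bound[OF int[OF U T] int[OF u T]])
      show "((\<lambda>t. C * norm (U n t - u t)) has_integral C * (\<integral>t. norm (U n t - u t) \<partial>?M)) {0..T}"
        using L1[OF U] L1[OF u] by (intro has_integral_mult_right has_integral_integral_lebesgue_on) auto
    qed (auto intro!: norm_blinfun_diff_bound C)
    then have "(\<lambda>n. S (U n) T - S u T) \<longlonglongrightarrow> 0"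
      by (intro Lim_null_comparison[OF always_eventually tendsto_mult_right_zero[OF lim]]) auto
    then have "(\<lambda>n. S (U n) T) \<longlonglongrightarrow> S u T" by (simp add: LIM_zero_iff)
    then show "(\<lambda>n. \<Phi> (U n)) \<longlonglongrightarrow> \<Phi> u"
      unfolding \<Phi>_def by (intro tendsto_intros)
  qed
  then obtain u0 where u0: "u0 \<in> L2 T" "\<And>v. v \<in> L2 T \<Longrightarrow> J u0 \<le> J v"
    and uniq: "\<And>v. v \<in> L2 T \<Longrightarrow> J v \<le> J u0 \<Longrightarrow> AE t in ?M. v t = u0 t" by blast
  define w0 where "w0 t = G t \<zeta> + S u0 t" for t
  have adm0: "(w0, u0) \<in> admissible_pairs G B T \<zeta>"
    using u0 by (simp add: admissible w0_def)
  have "cost T \<zeta>1 \<mu> (w0, u0) \<le> cost T \<zeta>1 \<mu> (w, u)" if "(w, u) \<in> admissible_pairs G B T \<zeta>" for w u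
    unfolding cost[OF adm0] cost[OF that] using that by (intro u0) (simp add: admissible)
  then have "optimal_pair G B T \<zeta>1 \<mu> \<zeta> (w0, u0)"
    unfolding optimal_pair_def is_arg_min_def using adm0 by (force simp: not_less)
  moreover have "(\<forall>t\<in>{0..T}. w t = w0 t) \<and> (AE t in ?M. u t = u0 t)"
    if opt: "optimal_pair G B T \<zeta>1 \<mu> \<zeta> (w, u)" for w u
  proof -
    have adm: "(w, u) \<in> admissible_pairs G B T \<zeta>"
      and "cost T \<zeta>1 \<mu> (w, u) \<le> cost T \<zeta>1 \<mu> (w0, u0)"
      using opt adm0 unfolding optimal_pair_def is_arg_min_def not_less[symmetric] by blast+
    then have "J u \<le> J u0" by (simp only: cost[OF adm] cost[OF adm0])
    then have ae: "AE t in ?M. u t = u0 t" using adm by (intro uniq) (simp_all add: admissible)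
    \<comment> \<open>The states must agree at every time although the controls agree only almost
      everywhere: the exceptional null set is invisible to each integral
      \<open>S u t\<close>.\<close>
    then have "AE t in lebesgue. t \<in> {0..T} \<longrightarrow> u t = u0 t"
      by (simp add: AE_restrict_space_iff)
    then obtain N where N: "N \<in> null_sets lebesgue" "{t. \<not> (t \<in> {0..T} \<longrightarrow> u t = u0 t)} \<subseteq> N"
      by (elim AE_E3) auto
    have "S u t = S u0 t" if "t \<in> {0..T}" for t
      unfolding S_def using that N
      by (intro integral_spike[of N]) (auto simp: negligible_iff_null_sets)
    then show ?thesis using adm ae by (simp add: admissible w0_def)
  qed
  ultimately show ?thesis by blast
qed

end
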